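(* Let $D$ be a Prüfer $v$-multiplication domain (PVMD). Then $D$ is completely integrally closed if and only if $\bigcap_{n=1}^{\infty}(I^n)_v=(0)$ for every proper $t$-invertible $t$-ideal $I$ of $D$.
   Context: $D$ is an integral domain with quotient field $K$. For a nonzero fractional ideal $I$ put $I^{-1}=\{x\in K\mid xI\subseteq D\}$, $I_v=(I^{-1})^{-1}$, and $I_t=\bigcup\{J_v\mid J\subseteq I,\ J \text{ a nonzero finitely generated fractional ideal}\}$. $I$ is a $t$-ideal if $I_t=I$, and $t$-invertible if $(II^{-1})_t=D$. A proper $t$-ideal of $D$ is a $t$-ideal $I\subsetneq D$. $D$ is a PVMD if every nonzero finitely generated ideal of $D$ is $t$-invertible. $D$ is completely integrally closed if whenever $x\in K$ and $0\ne r\in D$ satisfy $rx^n\in D$ for every integer $n\ge 1$, then $x\in D$. *)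

theory Defs
  imports "HOL-Computational_Algebra.Polynomial_Factorial"
begin

text \<open>
  The integral domain \<open>D\<close> is an arbitrary type \<open>'a::idom\<close>, its quotient field \<open>K\<close> is \<open>'a fract\<close>,
  and \<open>D\<close> is identified with its image under \<open>to_fract\<close>. Ideals of \<open>D\<close>, like
  fractional ideals, are subsets of \<open>'a fract\<close>. Properties of the domain as a whole take an
  argument of type \<open>'a itself\<close>.
\<close>

abbreviation dom_ring :: "'a::idom fract set"
  where "dom_ring \<equiv> range to_fract"

interpretation frac_module: module "\<lambda>(r :: 'a::idom) (x :: 'a fract). to_fract r * x"
  by unfold_locales (simp_all add: algebra_simps)

definition fractional_ideal :: "'a::idom fract set \<Rightarrow> bool"
  where "fractional_ideal I \<longleftrightarrow>
    frac_module.subspace I \<and> (\<exists>d. d \<noteq> 0 \<and> (\<forall>x\<in>I. to_fract d * x \<in> dom_ring))"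

definition nonzero_fractional_ideal :: "'a::idom fract set \<Rightarrow> bool"
  where "nonzero_fractional_ideal I \<longleftrightarrow> fractional_ideal I \<and> I \<noteq> {0}"

definition fin_gen :: "'a::idom fract set \<Rightarrow> bool"
  where "fin_gen I \<longleftrightarrow> (\<exists>S. finite S \<and> I = frac_module.span S)"

definition ideal_of_domain :: "'a::idom fract set \<Rightarrow> bool"
  where "ideal_of_domain I \<longleftrightarrow> frac_module.subspace I \<and> I \<subseteq> dom_ring"

definition ideal_mult :: "'a::idom fract set \<Rightarrow> 'a fract set \<Rightarrow> 'a fract set"
  where "ideal_mult I J = frac_module.span {x * y | x y. x \<in> I \<and> y \<in> J}"

fun ideal_power :: "'a::idom fract set \<Rightarrow> nat \<Rightarrow> 'a fract set"
  where
    "ideal_power I 0 = dom_ring"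
  | "ideal_power I (Suc n) = ideal_mult I (ideal_power I n)"

definition ideal_inverse :: "'a::idom fract set \<Rightarrow> 'a fract set"
  where "ideal_inverse I = {x. \<forall>y\<in>I. x * y \<in> dom_ring}"

definition v_closure :: "'a::idom fract set \<Rightarrow> 'a fract set"
  where "v_closure I = ideal_inverse (ideal_inverse I)"

definition t_closure :: "'a::idom fract set \<Rightarrow> 'a fract set"
  where "t_closure I = \<Union> {v_closure J | J. J \<subseteq> I \<and> nonzero_fractional_ideal J \<and> fin_gen J}"

text \<open>
  The operations above are meant for nonzero fractional ideals only; on other sets they are
  harmless junk, and the predicates below require a nonzero fractional ideal explicitly.
\<close>

definition t_ideal :: "'a::idom fract set \<Rightarrow> bool"
  where "t_ideal I \<longleftrightarrow> nonzero_fractional_ideal I \<and> t_closure I = I"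

definition t_invertible :: "'a::idom fract set \<Rightarrow> bool"
  where "t_invertible I \<longleftrightarrow>
    nonzero_fractional_ideal I \<and> t_closure (ideal_mult I (ideal_inverse I)) = dom_ring"

definition proper_t_ideal :: "'a::idom fract set \<Rightarrow> bool"
  where "proper_t_ideal I \<longleftrightarrow> t_ideal I \<and> I \<subset> dom_ring"

definition PVMD :: "'a::idom itself \<Rightarrow> bool"
  where "PVMD _ \<longleftrightarrow>
    (\<forall>I :: 'a fract set. ideal_of_domain I \<and> I \<noteq> {0} \<and> fin_gen I \<longrightarrow> t_invertible I)"

definition completely_integrally_closed :: "'a::idom itself \<Rightarrow> bool"
  where "completely_integrally_closed _ \<longleftrightarrow>
    (\<forall>(x :: 'a fract) (r :: 'a).
      r \<noteq> 0 \<and> (\<forall>n\<ge>1. to_fract r * x ^ n \<in> dom_ring) \<longrightarrow> x \<in> dom_ring)"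

end

theory Submission
  imports Defs
begin

text \<open>
  If \<open>D\<close> is completely integrally closed and \<open>I\<close> is a proper \<open>t\<close>-invertible \<open>t\<close>-ideal, then
  some \<open>x\<close> lies in \<open>I\<^sup>-\<^sup>1\<close> but not in \<open>D\<close>; a nonzero \<open>r\<close> in all \<open>(I\<^sup>n)\<^sub>v\<close> would satisfy
  \<open>r x\<^sup>n \<in> D\<close> for all \<open>n\<close>. Conversely, if \<open>r x\<^sup>n \<in> D\<close> for all \<open>n\<close> with \<open>r \<noteq> 0\<close> and \<open>x \<notin> D\<close>, put
  \<open>J = D + Dx\<close>. By the PVMD property \<open>I = J\<^sup>-\<^sup>1\<close> is a proper \<open>t\<close>-invertible \<open>t\<close>-ideal, and
  \<open>r \<in> (J\<^sup>n)\<^sup>-\<^sup>1 = (I\<^sup>n)\<^sub>v\<close> for all \<open>n\<close>.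
\<close>

section \<open>Inverses and the v-closure\<close>

lemma dom_ring_mult: "x \<in> dom_ring \<Longrightarrow> y \<in> dom_ring \<Longrightarrow> x * y \<in> dom_ring"
  by (auto simp flip: to_fract_mult)

lemma dom_ring_one: "1 \<in> dom_ring"
  by (auto simp flip: to_fract_1)

lemma subspace_dom_ring: "frac_module.subspace dom_ring"
  unfolding frac_module.subspace_def
  by (auto simp flip: to_fract_0 to_fract_add to_fract_mult)

lemma subspace_ideal_inverse: "frac_module.subspace (ideal_inverse S)"
proof (rule frac_module.subspaceI)
  show "0 \<in> ideal_inverse S"
    by (simp add: ideal_inverse_def frac_module.subspace_0[OF subspace_dom_ring])
  show "x + y \<in> ideal_inverse S" if "x \<in> ideal_inverse S" "y \<in> ideal_inverse S" for x y
    using that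
    by (auto simp: ideal_inverse_def distrib_right
        intro: frac_module.subspace_add[OF subspace_dom_ring])
  show "to_fract c * x \<in> ideal_inverse S" if "x \<in> ideal_inverse S" for c x
    using that
    by (auto simp: ideal_inverse_def mult.assoc
        intro: frac_module.subspace_scale[OF subspace_dom_ring])
qed

lemma ideal_inverse_antimono: "S \<subseteq> T \<Longrightarrow> ideal_inverse T \<subseteq> ideal_inverse S"
  by (auto simp: ideal_inverse_def)

text \<open>Both sides say that all products of an element of \<open>S\<close> and one of
  \<open>T\<close> lie in D. This Galois connection drives the closure arguments below.\<close>

lemma subset_ideal_inverse_iff: "S \<subseteq> ideal_inverse T \<longleftrightarrow> T \<subseteq> ideal_inverse S"
  unfolding ideal_inverse_def subset_iff mem_Collect_eq by (metis mult.commute)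

lemma subset_v_closure: "S \<subseteq> v_closure S"
  unfolding v_closure_def by (subst subset_ideal_inverse_iff) simp

lemma v_closure_mono: "S \<subseteq> T \<Longrightarrow> v_closure S \<subseteq> v_closure T"
  by (simp add: v_closure_def ideal_inverse_antimono)

lemma v_closure_ideal_inverse: "v_closure (ideal_inverse S) = ideal_inverse S"
  using subset_v_closure[of S] subset_v_closure[of "ideal_inverse S"]
  by (metis ideal_inverse_antimono subset_antisym v_closure_def)

text \<open>The v-closure of \<open>S\<close> is a submodule containing \<open>S\<close>, hence
  contains its span; the Galois connection turns this into the nontrivial inclusion. Inverses can
  thus be tested on generators.\<close>

lemma ideal_inverse_span: "ideal_inverse (frac_module.span S) = ideal_inverse S"
proof
  show "ideal_inverse (frac_module.span S) \<subseteq> ideal_inverse S"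
    by (intro ideal_inverse_antimono frac_module.span_superset)
  have "frac_module.span S \<subseteq> v_closure S"
    by (intro frac_module.span_minimal subset_v_closure)
      (simp add: v_closure_def subspace_ideal_inverse)
  then show "ideal_inverse S \<subseteq> ideal_inverse (frac_module.span S)"
    unfolding v_closure_def by (subst subset_ideal_inverse_iff)
qed

lemma ideal_inverse_dom_ring: "ideal_inverse dom_ring = dom_ring"
proof
  show "ideal_inverse dom_ring \<subseteq> dom_ring"
    unfolding ideal_inverse_def by (auto dest: spec[of _ 1])
  show "dom_ring \<subseteq> ideal_inverse dom_ring"
    unfolding ideal_inverse_def by (blast intro: dom_ring_mult)
qed

lemma v_closure_subset_dom_ring: "S \<subseteq> dom_ring \<Longrightarrow> v_closure S \<subseteq> dom_ring"
  by (metis v_closure_mono v_closure_ideal_inverse ideal_inverse_dom_ring)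

section \<open>The t-closure and t-invertibility\<close>

lemma t_closure_mono: "S \<subseteq> T \<Longrightarrow> t_closure S \<subseteq> t_closure T"
  unfolding t_closure_def by blast

lemma t_closure_subset_v_closure: "t_closure S \<subseteq> v_closure S"
  unfolding t_closure_def using v_closure_mono by blast

lemma fractional_ideal_principal: "fractional_ideal (frac_module.span {z})"
proof -
  obtain a b where ab: "z = Fract a b" "b \<noteq> 0"
    by (cases z) auto
  have "to_fract b * z = to_fract a"
    using ab by (simp add: Fract_conv_to_fract)
  moreover have "to_fract b * (to_fract k * z) = to_fract k * (to_fract b * z)" for k
    by (simp add: mult.left_commute)
  ultimately have "\<forall>x\<in>frac_module.span {z}. to_fract b * x \<in> dom_ring"
    by (auto simp: frac_module.span_singleton simp flip: to_fract_mult)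
  with ab(2) show ?thesis
    unfolding fractional_ideal_def using frac_module.subspace_span by blast
qed

lemma subset_t_closure:
  assumes "nonzero_fractional_ideal I"
  shows "I \<subseteq> t_closure I"
proof
  have sub: "frac_module.subspace I" and "I \<noteq> {0}"
    using assms by (auto simp: nonzero_fractional_ideal_def fractional_ideal_def)
  \<comment> \<open>\<open>t_closure\<close> ranges over nonzero J only, so 0 needs the principal
    ideal of some nonzero \<open>b\<close> as its witness.\<close>
  then obtain b where b: "b \<in> I" "b \<noteq> 0"
    using frac_module.subspace_0 by blast
  have principal: "frac_module.span {y} \<subseteq> I \<and> nonzero_fractional_ideal (frac_module.span {y})
      \<and> fin_gen (frac_module.span {y})" if "y \<in> I" "y \<noteq> 0" for y
    using that sub fractional_ideal_principal[of y] frac_module.span_base[of y "{y}"]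
    unfolding nonzero_fractional_ideal_def fin_gen_def
    by (metis empty_subsetI finite.emptyI finite_insert frac_module.span_minimal
        insert_subset singletonD singletonI)
  fix z assume "z \<in> I"
  show "z \<in> t_closure I"
  proof (cases "z = 0")
    case True
    have "0 \<in> v_closure (frac_module.span {b})"
      using subset_v_closure frac_module.span_zero by blast
    with True principal[OF b] show ?thesis
      unfolding t_closure_def by blast
  next
    case False
    have "z \<in> v_closure (frac_module.span {z})"
      using subset_v_closure frac_module.span_base by blast
    with principal[OF \<open>z \<in> I\<close> False] show ?thesis
      unfolding t_closure_def by blast
  qed
qed

text \<open>An inverse is v-closed, and the t-closure lies between a fractional ideal and its
  v-closure.\<close>

lemma t_ideal_ideal_inverse:
  assumes "nonzero_fractional_ideal (ideal_inverse S)"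
  shows "t_ideal (ideal_inverse S)"
  using assms subset_t_closure[OF assms] t_closure_subset_v_closure[of "ideal_inverse S"]
  by (simp add: t_ideal_def v_closure_ideal_inverse subset_antisym)

lemma nonzero_fractional_idealI:
  assumes "frac_module.subspace I" "I \<subseteq> dom_ring" "I \<noteq> {0}"
  shows "nonzero_fractional_ideal I"
  using assms
  by (auto simp: nonzero_fractional_ideal_def fractional_ideal_def intro!: exI[of _ 1])

lemma ideal_mult_inverse_subset_dom_ring: "ideal_mult I (ideal_inverse I) \<subseteq> dom_ring"
  unfolding ideal_mult_def
  by (rule frac_module.span_minimal[OF _ subspace_dom_ring])
    (auto simp: ideal_inverse_def mult.commute)

text \<open>The t-closure lies in the v-closure, so 1 is in the v-closure of the product; hence z =
  z * 1 is in D for every z in its inverse.\<close>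

lemma t_invertible_imp_ideal_inverse:
  assumes "t_invertible I"
  shows "ideal_inverse (ideal_mult I (ideal_inverse I)) \<subseteq> dom_ring"
proof
  fix z assume z: "z \<in> ideal_inverse (ideal_mult I (ideal_inverse I))"
  have "1 \<in> t_closure (ideal_mult I (ideal_inverse I))"
    using assms by (simp add: t_invertible_def dom_ring_one)
  then have "1 \<in> v_closure (ideal_mult I (ideal_inverse I))"
    by (rule subsetD[OF t_closure_subset_v_closure])
  with z show "z \<in> dom_ring"
    unfolding v_closure_def ideal_inverse_def[of "ideal_inverse _"] by fastforce
qed

lemma power_mem_ideal_inverse_power:
  assumes "x \<in> ideal_inverse I"
  shows "x ^ n \<in> ideal_inverse (ideal_power I n)"
proof (induction n)
  case 0
  show ?case by (simp add: ideal_inverse_dom_ring dom_ring_one)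
next
  case (Suc n)
  have "x * x ^ n * (i * j) \<in> dom_ring" if "i \<in> I" "j \<in> ideal_power I n" for i j
  proof -
    have "(x * i) * (x ^ n * j) \<in> dom_ring"
      by (rule dom_ring_mult) (use assms Suc that in \<open>auto simp: ideal_inverse_def\<close>)
    then show ?thesis by (simp add: mult_ac)
  qed
  then show ?case
    by (auto simp: ideal_mult_def ideal_inverse_span) (auto simp: ideal_inverse_def)
qed

section \<open>From complete integral closure to zero intersections\<close>

lemma completely_integrally_closed_imp_Inter_powers:
  fixes I :: "'a::idom fract set"
  assumes cic: "completely_integrally_closed TYPE('a)"
    and "proper_t_ideal I" "t_invertible I"
  shows "(\<Inter>n\<in>{1..}. v_closure (ideal_power I n)) = {0}"
proof -
  have I: "I \<subseteq> dom_ring" "I \<noteq> dom_ring" "t_closure I = I" "frac_module.subspace I"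
    using assms
    by (auto simp: proper_t_ideal_def t_ideal_def nonzero_fractional_ideal_def
        fractional_ideal_def)
  \<comment> \<open>Otherwise the product of \<open>I\<close> and its inverse lies in
    \<open>I\<close>; taking t-closures gives D \<subseteq> \<open>I\<close>, although
    \<open>I\<close> is proper.\<close>
  have "\<not> ideal_inverse I \<subseteq> dom_ring"
  proof
    assume "ideal_inverse I \<subseteq> dom_ring"
    have "i * j \<in> I" if "i \<in> I" "j \<in> ideal_inverse I" for i j
    proof -
      from that(2) \<open>ideal_inverse I \<subseteq> dom_ring\<close> obtain d where "j = to_fract d"
        by blast
      then show ?thesis
        using frac_module.subspace_scale[OF I(4) that(1), of d] by (simp add: mult.commute)
    qed
    then have "ideal_mult I (ideal_inverse I) \<subseteq> I"
      unfolding ideal_mult_def by (intro frac_module.span_minimal I(4)) auto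
    then have "dom_ring \<subseteq> I"
      using t_closure_mono assms(3) I(3) unfolding t_invertible_def by metis
    with I show False by blast
  qed
  then obtain x where x: "x \<in> ideal_inverse I" "x \<notin> dom_ring" by blast
  have "r = 0" if r: "r \<in> (\<Inter>n\<in>{1..}. v_closure (ideal_power I n))" for r
  proof (rule ccontr)
    assume "r \<noteq> 0"
    have rx: "r * x ^ n \<in> dom_ring" if "n \<ge> 1" for n
      using r that power_mem_ideal_inverse_power[OF x(1), of n]
      by (auto simp: v_closure_def ideal_inverse_def)
    \<comment> \<open>Complete integral closure needs \<open>r\<close> in D; the term n = 1 of the
      intersection supplies this.\<close>
    have "ideal_mult I dom_ring \<subseteq> dom_ring"
      unfolding ideal_mult_def using I(1)
      by (intro frac_module.span_minimal subspace_dom_ring) (auto intro: dom_ring_mult)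
    then have "v_closure (ideal_power I 1) \<subseteq> dom_ring"
      by (simp only: One_nat_def ideal_power.simps v_closure_subset_dom_ring)
    moreover have "r \<in> v_closure (ideal_power I 1)"
      using r by (rule INT_D) simp
    ultimately obtain d where "r = to_fract d" by blast
    with \<open>r \<noteq> 0\<close> rx cic x(2) show False
      unfolding completely_integrally_closed_def by auto
  qed
  moreover have "0 \<in> v_closure (ideal_power I n)" for n
    unfolding v_closure_def by (intro frac_module.subspace_0 subspace_ideal_inverse)
  ultimately show ?thesis by blast
qed

section \<open>From zero intersections to complete integral closure\<close>

text \<open>With \<open>J = D + Dx\<close>, this says that \<open>w (IJ)\<^sup>n \<subseteq> D\<close> implies \<open>w \<in> D\<close> once \<open>(IJ)\<^sup>-\<^sup>1 = D\<close>.\<close>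
lemma mem_dom_ring_if_mult_powers:
  fixes I :: "'a::idom fract set"
  assumes cancel: "\<And>w. (\<And>i. i \<in> I \<Longrightarrow> w * i \<in> dom_ring \<and> w * i * x \<in> dom_ring) \<Longrightarrow> w \<in> dom_ring"
    and "\<And>i k. i \<in> ideal_power I n \<Longrightarrow> k \<le> n \<Longrightarrow> w * i * x ^ k \<in> dom_ring"
  shows "w \<in> dom_ring"
  using assms(2)
proof (induction n)
  case 0
  from "0.prems"[of 1 0] show ?case by (simp add: dom_ring_one)
next
  case (Suc n)
  show ?case
  proof (rule Suc.IH)
    fix j k assume j: "j \<in> ideal_power I n" and k: "k \<le> n"
    show "w * j * x ^ k \<in> dom_ring"
    \<comment> \<open>One factor \<open>i\<close> is cancelled from w * j * x^k. The two conditions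
      are the hypothesis for i * j in the next power, with exponents k and k + 1, both at most n +
      1.\<close>
    proof (rule cancel)
      fix i assume "i \<in> I"
      then have "i * j \<in> ideal_power I (Suc n)"
        using j by (auto simp: ideal_mult_def intro!: frac_module.span_base)
      from Suc.prems[OF this, of k] Suc.prems[OF this, of "Suc k"] k
      show "w * j * x ^ k * i \<in> dom_ring \<and> w * j * x ^ k * i * x \<in> dom_ring"
        by (simp add: mult_ac)
    qed
  qed
qed

lemma mem_ideal_inverse_pair:
  "z \<in> ideal_inverse {1, x} \<longleftrightarrow> z \<in> dom_ring \<and> z * x \<in> dom_ring"
  by (simp add: ideal_inverse_def)

text \<open>The PVMD property speaks of ideals inside D, so J = D + Dx is scaled by a denominator b
  of x to A = bJ. The factor b cancels in the product of A and its inverse, which therefore lies in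
  the product of I = \<open>ideal_inverse {1, x}\<close> and its inverse, since J lies in the
  inverse of I.\<close>

lemma t_invertible_ideal_inverse_pair:
  fixes x :: "'a::idom fract"
  assumes "PVMD TYPE('a)"
    and nfi: "nonzero_fractional_ideal (ideal_inverse {1, x})"
  shows "t_invertible (ideal_inverse {1, x})"
proof -
  let ?I = "ideal_inverse {1, x}"
  obtain p q where pq: "x = Fract p q" "q \<noteq> 0"
    by (cases x) auto
  define a b where "a = to_fract p" and "b = to_fract q"
  have ab: "b \<noteq> 0" "a \<in> dom_ring" "b \<in> dom_ring" "a = b * x"
    using pq by (simp_all add: a_def b_def Fract_conv_to_fract)
  let ?A = "frac_module.span {a, b}"
  have "?A \<subseteq> dom_ring"
    using ab by (intro frac_module.span_minimal subspace_dom_ring) auto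
  moreover have "?A \<noteq> {0}"
    using ab(1) frac_module.span_base[of b "{a, b}"] by auto
  ultimately have "t_invertible ?A"
    using assms(1) unfolding PVMD_def ideal_of_domain_def fin_gen_def
    by (metis finite.emptyI finite_insert frac_module.subspace_span)
  have "ideal_mult ?A (ideal_inverse ?A) \<subseteq> ideal_mult ?I (ideal_inverse ?I)"
    unfolding ideal_mult_def
  proof (intro frac_module.span_mono subsetI)
    fix w assume "w \<in> {y * z |y z. y \<in> ?A \<and> z \<in> ideal_inverse ?A}"
    then obtain y z where yz: "w = y * z" "y \<in> ?A" "z \<in> ideal_inverse ?A" by blast
    have z: "z * b \<in> ?I"
      using yz(3) ab(4) by (simp add: ideal_inverse_span) (simp add: ideal_inverse_def mult_ac)
    have "y / b * u \<in> dom_ring" if "u \<in> ?I" for u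
    proof -
      have "u / b \<in> ideal_inverse {a, b}"
        using that ab(1,4) by (simp add: ideal_inverse_def)
      then have "u / b * y \<in> dom_ring"
        using yz(2) unfolding ideal_inverse_span[symmetric, of "{a, b}"]
        by (simp add: ideal_inverse_def)
      then show ?thesis by (simp add: mult.commute)
    qed
    then have y: "y / b \<in> ideal_inverse ?I"
      by (simp add: ideal_inverse_def)
    have "w = (z * b) * (y / b)"
      using yz(1) ab(1) by simp
    with z y show "w \<in> {y * z |y z. y \<in> ?I \<and> z \<in> ideal_inverse ?I}" by blast
  qed
  then have "dom_ring \<subseteq> t_closure (ideal_mult ?I (ideal_inverse ?I))"
    using \<open>t_invertible ?A\<close> t_closure_mono unfolding t_invertible_def by metis
  moreover have "t_closure (ideal_mult ?I (ideal_inverse ?I)) \<subseteq> dom_ring"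
    using t_closure_subset_v_closure v_closure_subset_dom_ring ideal_mult_inverse_subset_dom_ring
    by (metis subset_trans)
  ultimately show ?thesis
    using nfi by (simp add: t_invertible_def)
qed

lemma Inter_powers_imp_completely_integrally_closed:
  assumes "PVMD TYPE('a::idom)"
    and zero: "\<And>I :: 'a fract set. proper_t_ideal I \<Longrightarrow> t_invertible I \<Longrightarrow>
      (\<Inter>n\<in>{1..}. v_closure (ideal_power I n)) = {0}"
  shows "completely_integrally_closed TYPE('a)"
  unfolding completely_integrally_closed_def
proof (intro allI impI, elim conjE)
  fix x :: "'a fract" and r :: 'a
  assume "r \<noteq> 0" and rx: "\<forall>n\<ge>1. to_fract r * x ^ n \<in> dom_ring"
  \<comment> \<open>The exponent 0 is included because membership of \<open>r\<close> in
    \<open>I\<close> and the exponents k = 0 below use it.\<close>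
  have rx: "to_fract r * x ^ n \<in> dom_ring" for n
    using rx by (cases "n = 0") simp_all
  define I where "I = ideal_inverse {1, x}"
  show "x \<in> dom_ring"
  proof (rule ccontr)
    assume x: "x \<notin> dom_ring"
    have "I \<subseteq> dom_ring"
      by (auto simp: I_def mem_ideal_inverse_pair)
    moreover have "to_fract r \<in> I"
      using rx[of 0] rx[of 1] by (simp add: I_def mem_ideal_inverse_pair)
    then have "I \<noteq> {0}"
      using \<open>r \<noteq> 0\<close> by auto
    ultimately have nfi: "nonzero_fractional_ideal I"
      unfolding I_def by (intro nonzero_fractional_idealI subspace_ideal_inverse)
    have "1 \<notin> I"
      using x by (simp add: I_def mem_ideal_inverse_pair)
    then have "I \<noteq> dom_ring"
      using dom_ring_one[where ?'a = 'a] by blast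
    then have "proper_t_ideal I"
      using \<open>I \<subseteq> dom_ring\<close> t_ideal_ideal_inverse[of "{1, x}"] nfi
      by (simp add: proper_t_ideal_def I_def psubset_eq)
    moreover have tinv: "t_invertible I"
      using t_invertible_ideal_inverse_pair assms(1) nfi unfolding I_def by blast
    ultimately have "(\<Inter>n\<in>{1..}. v_closure (ideal_power I n)) = {0}"
      by (rule zero)
    moreover have "to_fract r \<in> v_closure (ideal_power I n)" for n
    proof -
      \<comment> \<open>The n-th power of IJ is cancelled from r * z: \<open>z\<close> brings
        \<open>i\<close> into D, and \<open>r\<close> brings x^k into D.\<close>
      have "to_fract r * z \<in> dom_ring" if z: "z \<in> ideal_inverse (ideal_power I n)" for z
      proof (rule mem_dom_ring_if_mult_powers)
        fix i k assume "i \<in> ideal_power I n" "k \<le> n"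
        then have "(z * i) * (to_fract r * x ^ k) \<in> dom_ring"
          by (intro dom_ring_mult[OF _ rx]) (use z in \<open>simp add: ideal_inverse_def\<close>)
        then show "to_fract r * z * i * x ^ k \<in> dom_ring"
          by (simp add: mult_ac)
      next
        fix w assume w: "\<And>i. i \<in> I \<Longrightarrow> w * i \<in> dom_ring \<and> w * i * x \<in> dom_ring"
        \<comment> \<open>The assumption on \<open>w\<close> says that w * i is again in
          \<open>I\<close>. Thus \<open>w\<close> multiplies the product of \<open>I\<close> and its
          inverse into D, and t-invertibility puts \<open>w\<close> in D.\<close>
        have "w * (i * j) \<in> dom_ring" if "i \<in> I" "j \<in> ideal_inverse I" for i j
        proof -
          have "w * i \<in> I"
            using w[OF that(1)] by (simp add: I_def mem_ideal_inverse_pair)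
          then have "j * (w * i) \<in> dom_ring"
            using that(2) by (simp add: ideal_inverse_def)
          then show ?thesis by (simp add: mult_ac)
        qed
        then have "w \<in> ideal_inverse (ideal_mult I (ideal_inverse I))"
          unfolding ideal_mult_def ideal_inverse_span
          by (subst ideal_inverse_def) blast
        then show "w \<in> dom_ring"
          using t_invertible_imp_ideal_inverse[OF tinv] by blast
      qed
      then show ?thesis
        unfolding v_closure_def by (subst ideal_inverse_def) blast
    qed
    ultimately have "to_fract r \<in> {0}" by blast
    with \<open>r \<noteq> 0\<close> show False by simp
  qed
qed

theorem theorem0p2:
  assumes "PVMD TYPE('a::idom)"
  shows "completely_integrally_closed TYPE('a) \<longleftrightarrow>
    (\<forall>I :: 'a fract set. proper_t_ideal I \<and> t_invertible I \<longrightarrow>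
      (\<Inter>n\<in>{1..}. v_closure (ideal_power I n)) = {0})"
  using completely_integrally_closed_imp_Inter_powers
    Inter_powers_imp_completely_integrally_closed[OF assms] by blast

end
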